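(* Let $\Psi=(\psi_n)_{n=1}^\infty$ and $\Phi=(\phi_n)_{n=1}^\infty$ be Bessel sequences in separable Hilbert spaces $\mathcal{H}_1$ and $\mathcal{H}_2$, respectively, and let $m=(m_n)_{n=1}^\infty\subseteq\mathbb{C}$ be semi-normalized. Assume that the multiplier $M:=M_{m,\Phi,\Psi}:\mathcal{H}_1\to\mathcal{H}_2$ has closed range, and let $W\subseteq\mathcal{H}_1$, $V\subseteq\mathcal{H}_2$ be closed subspaces with $\mathcal{H}_1=W\oplus\ker(M)$ and $\mathcal{H}_2=\operatorname{ran}(M)\oplus V$. Let $M^{\#}_{W,V}$ be the oblique pseudoinverse of $M$ on $W$ along $V$. Put $\Psi^K=(\psi^K_n)_n:=\pi^*_{W,\ker(M)}\Psi$ and $\Phi^R=(\phi^R_n)_n:=\pi_{\operatorname{ran}(M),V}\Phi$, and let $\widetilde{\Psi}^K:=\pi_{W,\ker(M)}S^\dagger_{\Psi^K}\Psi^K$ and $\widetilde{\Phi}^R:=\pi^*_{\operatorname{ran}(M),V}S^\dagger_{\Phi^R}\Phi^R$ be their canonical oblique dual frames. If there exists a bounded operator $U:\mathcal{H}_2\to\mathcal{H}_1$ such that $U\phi^R_n=\overline{m_n}\psi^K_n$ for all $n\in\mathbb{N}$, then $M^{\#}_{W,V}=M_{1/m,\widetilde{\Psi}^K,\widetilde{\Phi}^R}$.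
   Context: Here $X\oplus Y$ denotes a direct sum, not necessarily orthogonal. A sequence $(x_n)$ in a Hilbert space $\mathcal{H}$ is a Bessel sequence if there is $B>0$ with $\sum_n|\langle h,x_n\rangle|^2\le B\|h\|^2$ for all $h\in\mathcal{H}$; a sequence in a closed subspace $X$ is a frame for $X$ if there are $A,B>0$ with $A\|h\|^2\le\sum_n|\langle h,x_n\rangle|^2\le B\|h\|^2$ for all $h\in X$. For a Bessel sequence $F=(f_n)$ in $\mathcal{H}$, $T_F:\ell^2(\mathbb{N})\to\mathcal{H}$, $T_F(c_n)=\sum_n c_nf_n$, is the synthesis operator, and $S_F:=T_FT_F^*:\mathcal{H}\to\mathcal{H}$, $S_Fh=\sum_n\langle h,f_n\rangle f_n$, is the frame operator. $S_F^\dagger$ denotes the Moore–Penrose inverse of $S_F$ (which exists as a bounded operator when $S_F$ has closed range, in particular when $F$ is a frame for a closed subspace of $\mathcal{H}$). Under the hypotheses, $\Psi^K$ and $\Phi^R$ are frames for $\ker(M)^\perp$ and $\operatorname{ran}(M)$, respectively. For sequences $\Psi$ in $\mathcal{H}_1$, $\Phi$ in $\mathcal{H}_2$ and scalars $m$, the multiplier is $M_{m,\Phi,\Psi}h=\sum_n m_n\langle h,\psi_n\rangle\phi_n$ (second index: synthesis sequence; third index: analysis sequence). For Bessel sequences and bounded $m$ it is a bounded operator. The sequence $m$ is semi-normalized if $0<\inf_n|m_n|\le\sup_n|m_n|<\infty$; $1/m=(1/m_n)_n$. If $\mathcal{H}=X\oplus Z$ with $X,Z$ closed, $\pi_{X,Z}$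 is the oblique projection onto $X$ along $Z$: $\pi_{X,Z}(x+z)=x$ for $x\in X$, $z\in Z$. For an operator $L$ and sequence $F=(f_n)$, $LF:=(Lf_n)_n$. Oblique pseudoinverse: for a bounded operator $M:\mathcal{H}_1\to\mathcal{H}_2$ with closed range and closed subspaces $W,V$ with $\mathcal{H}_1=W\oplus\ker(M)$, $\mathcal{H}_2=\operatorname{ran}(M)\oplus V$, each $y\in\mathcal{H}_2$ can be written as $y=Mx_y+z_y$ with unique $x_y\in W$, $z_y\in V$; the oblique pseudoinverse of $M$ on $W$ along $V$ is $M^{\#}_{W,V}y:=x_y$. It is a bounded linear operator $\mathcal{H}_2\to\mathcal{H}_1$. *)

theory Defs
  imports "HOL-Analysis.Analysis"
begin

section \<open>Complex Hilbert spaces\<close>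

class complex_vector = real_vector +
  fixes scaleC :: "complex \<Rightarrow> 'a \<Rightarrow> 'a"  (infixr \<open>*\<^sub>C\<close> 75)
  assumes scaleC_add_right: "a *\<^sub>C (x + y) = a *\<^sub>C x + a *\<^sub>C y"
    and scaleC_add_left: "(a + b) *\<^sub>C x = a *\<^sub>C x + b *\<^sub>C x"
    and scaleC_scaleC: "a *\<^sub>C b *\<^sub>C x = (a * b) *\<^sub>C x"
    and scaleC_one: "1 *\<^sub>C x = x"
    and scaleC_of_real: "complex_of_real r *\<^sub>C x = r *\<^sub>R x"

global_interpretation complex_vector:
  vector_space "scaleC :: complex \<Rightarrow> 'a \<Rightarrow> 'a::complex_vector"
  by unfold_locales
    (rule scaleC_add_right scaleC_add_left scaleC_scaleC scaleC_one)+

text \<open>The inner product is linear in the first argument and conjugate-linear in the second.\<close>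

class complex_inner = complex_vector + real_normed_vector +
  fixes cinner :: "'a \<Rightarrow> 'a \<Rightarrow> complex"
  assumes cinner_commute: "cinner x y = cnj (cinner y x)"
    and cinner_add_left: "cinner (x + y) z = cinner x z + cinner y z"
    and cinner_scaleC_left: "cinner (a *\<^sub>C x) y = a * cinner x y"
    and cinner_self: "cinner x x = complex_of_real ((norm x)\<^sup>2)"

class chilbert_space = complex_inner + complete_space

subclass (in chilbert_space) banach ..

instantiation complex :: chilbert_space
begin

definition scaleC_complex :: "complex \<Rightarrow> complex \<Rightarrow> complex"
  where "scaleC_complex a x = a * x"

definition cinner_complex :: "complex \<Rightarrow> complex \<Rightarrow> complex"
  where "cinner_complex x y = x * cnj y"

instance
  by standard
    (simp_all add: scaleC_complex_def cinner_complex_def algebra_simps scaleR_conv_of_real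
      complex_norm_square del: of_real_power)

end


section \<open>Operators and subspaces\<close>

abbreviation csubspace :: "'a::complex_vector set \<Rightarrow> bool"
  where "csubspace \<equiv> complex_vector.subspace"

abbreviation closed_csubspace :: "'a::complex_inner set \<Rightarrow> bool"
  where "closed_csubspace X \<equiv> csubspace X \<and> closed X"

definition bounded_clinear :: "('a::complex_inner \<Rightarrow> 'b::complex_inner) \<Rightarrow> bool"
  where "bounded_clinear A \<longleftrightarrow>
    Vector_Spaces.linear scaleC scaleC A \<and> (\<exists>K. \<forall>x. norm (A x) \<le> norm x * K)"

definition ker :: "('a \<Rightarrow> 'b::zero) \<Rightarrow> 'a set"
  where "ker A = {x. A x = 0}"

definition is_adjoint ::
    "('a::complex_inner \<Rightarrow> 'b::complex_inner) \<Rightarrow> ('b \<Rightarrow> 'a) \<Rightarrow> bool"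
  where "is_adjoint A B \<longleftrightarrow> (\<forall>x y. cinner (A x) y = cinner x (B y))"

definition cadjoint :: "('a::chilbert_space \<Rightarrow> 'b::chilbert_space) \<Rightarrow> 'b \<Rightarrow> 'a"
  where "cadjoint A = (THE B. is_adjoint A B)"

text \<open>The four Penrose equations; the last two say that \<open>A \<circ> B\<close> and \<open>B \<circ> A\<close> are
  self-adjoint.\<close>

definition is_moore_penrose ::
    "('a::chilbert_space \<Rightarrow> 'b::chilbert_space) \<Rightarrow> ('b \<Rightarrow> 'a) \<Rightarrow> bool"
  where "is_moore_penrose A B \<longleftrightarrow>
    bounded_clinear B \<and> A \<circ> B \<circ> A = A \<and> B \<circ> A \<circ> B = B \<and>
    is_adjoint (A \<circ> B) (A \<circ> B) \<and> is_adjoint (B \<circ> A) (B \<circ> A)"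

definition moore_penrose ::
    "('a::chilbert_space \<Rightarrow> 'b::chilbert_space) \<Rightarrow> 'b \<Rightarrow> 'a"
  where "moore_penrose A = (THE B. is_moore_penrose A B)"

text \<open>The whole space is the direct, not necessarily orthogonal, sum of \<open>X\<close> and \<open>Z\<close>.\<close>

definition direct_sum_decomp :: "'a::complex_vector set \<Rightarrow> 'a set \<Rightarrow> bool"
  where "direct_sum_decomp X Z \<longleftrightarrow>
    X \<inter> Z = {0} \<and> (\<forall>h. \<exists>x\<in>X. \<exists>z\<in>Z. h = x + z)"

definition oblique_proj :: "'a::complex_vector set \<Rightarrow> 'a set \<Rightarrow> 'a \<Rightarrow> 'a"
  where "oblique_proj X Z h = (THE x. x \<in> X \<and> (\<exists>z\<in>Z. h = x + z))"

definition oblique_pinv ::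
    "'a::complex_vector set \<Rightarrow> 'b::complex_vector set \<Rightarrow> ('a \<Rightarrow> 'b) \<Rightarrow> 'b \<Rightarrow> 'a"
  where "oblique_pinv W V M y = (THE x. x \<in> W \<and> (\<exists>z\<in>V. y = M x + z))"


section \<open>Bessel sequences and multipliers\<close>

definition bessel_seq :: "(nat \<Rightarrow> 'a::complex_inner) \<Rightarrow> bool"
  where "bessel_seq f \<longleftrightarrow>
    (\<exists>B>0. \<forall>h. summable (\<lambda>n. (cmod (cinner h (f n)))\<^sup>2) \<and>
      (\<Sum>n. (cmod (cinner h (f n)))\<^sup>2) \<le> B * (norm h)\<^sup>2)"

definition semi_normalized :: "(nat \<Rightarrow> complex) \<Rightarrow> bool"
  where "semi_normalized m \<longleftrightarrow>
    0 < (INF n. cmod (m n)) \<and> bdd_above (range (\<lambda>n. cmod (m n)))"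

text \<open>\<open>multiplier m \<phi> \<psi>\<close> synthesizes with \<open>\<phi>\<close> and analyses with \<open>\<psi>\<close>.\<close>

definition multiplier ::
    "(nat \<Rightarrow> complex) \<Rightarrow> (nat \<Rightarrow> 'b::complex_inner) \<Rightarrow> (nat \<Rightarrow> 'a::complex_inner) \<Rightarrow> 'a \<Rightarrow> 'b"
  where "multiplier m \<phi> \<psi> h = (\<Sum>n. (m n * cinner h (\<psi> n)) *\<^sub>C \<phi> n)"

text \<open>The composition of the synthesis operator \<open>c \<mapsto> \<Sum>n. c n *\<^sub>C f n\<close> on square-summable
  sequences with its adjoint \<open>h \<mapsto> (\<lambda>n. cinner h (f n))\<close>.\<close>

definition frame_op :: "(nat \<Rightarrow> 'a::complex_inner) \<Rightarrow> 'a \<Rightarrow> 'a"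
  where "frame_op f h = (\<Sum>n. cinner h (f n) *\<^sub>C f n)"

end

(*
  Write P and Q for the oblique projections onto W along ker M and onto ran M along V. Since
  Q M P = M, the operator M is also the multiplier with symbol m built from \<Phi>^R and \<Psi>^K. The adjoint
  of U satisfies <U*x, \<phi>^R_n> = m_n <x, \<psi>^K_n>, so M = S U* with S the frame operator of \<Phi>^R, and
  ran S = ran M. Hence, if y = M x + z with x in W and z in V, the coefficient of y against the dual
  of \<Phi>^R is <S^+ S U*x, \<phi>^R_n> = m_n <x, \<psi>^K_n>. The weights cancel, and the multiplier with symbol
  1/m sends y to P T^+ T x = x, where T is the frame operator of \<Psi>^K, because ker T = ker M = ker P.
*)
theory Submission
  imports Defs
begin

section \<open>The closed graph theorem\<close>

text \<open>The two dual sequences need different arguments. \<open>U\<close> gives the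
  factorization of M through S, which settles the range of S at once, but it does not factor T. For
  T, both the kernel and the closed range come from the estimate norm (M h)^2 \<le> B * <T h, h>,
  which holds because M sees h only through its coefficients against \<Psi>^K; combined with the
  lower bound of M on the orthogonal complement of its kernel, it bounds T below there too. The
  final series is not made to converge by a Bessel bound for the duals. Its terms equal those of the
  expansion of T x, carried over by the bounded operator P T^+. Adjoints, oblique projections and
  both kinds of pseudoinverse are definite descriptions, so each must be shown to exist and to be
  unique before it can be used. The hypotheses give only algebraic decompositions into closed
  subspaces; the closed graph theorem turns these into bounded operators.\<close>

lemma closed_graph_bounded_linear:
  fixes f :: "'a::banach \<Rightarrow> 'b::banach"
  assumes lin: "linear f"
    and graph: "\<And>u x y. u \<longlonglongrightarrow> x \<Longrightarrow> (\<lambda>n. f (u n)) \<longlonglongrightarrow> y \<Longrightarrow> f x = y"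
  shows "bounded_linear f"
proof -
  \<comment> \<open>The sublevel sets of norm (f x) cover the space, so by Baire one of their
    closures contains a ball.\<close>
  define E where "E k = closure {x. norm (f x) \<le> real k}" for k :: nat
  have "\<exists>k. interior (E k) \<noteq> {}"
  proof (rule ccontr)
    assume "\<nexists>k. interior (E k) \<noteq> {}"
    then have "euclidean interior_of \<Union>(range E) = {}"
      by (intro Baire_category_alt)
        (auto simp: completely_metrizable_space_euclidean E_def)
    moreover have "\<Union>(range E) = UNIV"
    proof -
      have "x \<in> \<Union>(range E)" for x
      proof -
        obtain k :: nat where "norm (f x) \<le> real k"
          using real_arch_simple[of "norm (f x)"] by auto
        then have "x \<in> E k"
          unfolding E_def by (intro subsetD[OF closure_subset]) simp
        then show ?thesis by blast
      qed
      then show ?thesis by blast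
    qed
    ultimately show False by simp
  qed
  then obtain k a e where e: "0 < e" and ball: "ball a e \<subseteq> E k"
    by (metis all_not_in_conv mem_interior)
  \<comment> \<open>The ball in \<open>E k\<close> is centred at \<open>a\<close>, not at 0.
    Approximating both \<open>a + x\<close> and \<open>a - x\<close> and taking half the difference
    removes the centre without enlarging the bound \<open>k\<close>.\<close>
  have approx0: "\<exists>y. norm (f y) \<le> real k \<and> norm (x - y) < d" if "norm x < e" "0 < d" for x d
  proof -
    have "a + x \<in> E k" "a - x \<in> E k"
      using ball that by (auto simp: dist_norm subset_iff)
    moreover have "\<exists>u. norm (f u) \<le> real k \<and> dist u z < d" if "z \<in> E k" for z
      using that \<open>0 < d\<close> by (auto simp: E_def closure_approachable)
    ultimately obtain u v where u: "norm (f u) \<le> real k" "dist u (a + x) < d"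
      and v: "norm (f v) \<le> real k" "dist v (a - x) < d"
      by metis
    define y where "y = (1/2) *\<^sub>R (u - v)"
    have "f y = (1/2) *\<^sub>R (f u - f v)"
      by (simp add: y_def lin linear_diff linear_scale)
    then have "norm (f y) \<le> real k"
      using u(1) v(1) norm_triangle_ineq4[of "f u" "f v"] by simp
    moreover have "x - y = (1/2) *\<^sub>R ((v - (a - x)) - (u - (a + x)))"
      by (simp add: y_def algebra_simps flip: scaleR_left.add)
    then have "norm (x - y) < d"
      using u(2) v(2) norm_triangle_ineq4[of "v - (a - x)" "u - (a + x)"] by (simp add: dist_norm)
    ultimately show ?thesis by blast
  qed
  have approx: "\<exists>y. norm (f y) \<le> k / 2 ^ n \<and> norm (x - y) < e / 2 ^ Suc n"
    if "norm x < e / 2 ^ n" for x n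
  proof -
    have "norm ((2 ^ n) *\<^sub>R x) < e"
      using that by (simp add: field_simps)
    from approx0[OF this, of "e / 2"] e obtain y
      where y: "norm (f y) \<le> real k" "norm ((2 ^ n) *\<^sub>R x - y) < e / 2" by auto
    define z where "z = (1 / 2 ^ n) *\<^sub>R y"
    have "norm (f z) \<le> k / 2 ^ n"
      using y(1) by (simp add: z_def lin linear_scale divide_right_mono)
    moreover have "x - z = (1 / 2 ^ n) *\<^sub>R ((2 ^ n) *\<^sub>R x - y)"
      by (simp add: z_def scaleR_diff_right)
    then have "norm (x - z) = norm ((2 ^ n) *\<^sub>R x - y) / 2 ^ n"
      by (simp only: norm_scaleR) simp
    then have "norm (x - z) < e / 2 ^ Suc n"
      using y(2) by (simp add: field_simps)
    ultimately show ?thesis by blast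
  qed
  \<comment> \<open>One step of successive approximation: \<open>g n x\<close> removes most of
    \<open>x\<close>, and the residual is small enough for step \<open>Suc n\<close>.\<close>
  define g where "g n x = (SOME y. norm (f y) \<le> k / 2 ^ n \<and> norm (x - y) < e / 2 ^ Suc n)" for n x
  have g: "norm (f (g n x)) \<le> k / 2 ^ n \<and> norm (x - g n x) < e / 2 ^ Suc n"
    if "norm x < e / 2 ^ n" for x n
    unfolding g_def by (rule someI_ex) (rule approx[OF that])
  have bound: "norm (f x) \<le> 2 * k" if x: "norm x < e" for x
  proof -
    define r where "r = rec_nat x (\<lambda>n r. r - g n r)"
    have r0: "r 0 = x" and rS: "r (Suc n) = r n - g n (r n)" for n
      by (simp_all add: r_def)
    have r: "norm (r n) < e / 2 ^ n" for n
      by (induction n) (use x g in \<open>auto simp: r0 rS\<close>)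
    define y where "y n = f (g n (r n))" for n
    have y: "norm (y n) \<le> k * (1/2) ^ n" for n
      using g[OF r[of n]] by (simp add: y_def field_simps)
    have sm: "summable (\<lambda>n. k * (1/2::real) ^ n)"
      by (intro summable_mult summable_geometric) simp
    have yn: "summable (\<lambda>n. norm (y n))"
      by (rule summable_comparison_test'[OF sm]) (use y in auto)
    \<comment> \<open>Telescoping: \<open>x - r n\<close> is the sum of the first \<open>n\<close>
      approximants, whose images are dominated by a geometric series with sum
      \<open>2 * k\<close>.\<close>
    have fx: "f (x - r n) = (\<Sum>i<n. y i)" for n
    proof (induction n)
      case (Suc n)
      have "f (x - r (Suc n)) = f (x - r n) + y n"
        by (simp add: rS y_def lin linear_diff)
      with Suc show ?case by simp
    qed (simp add: r0 lin linear_0)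
    have "r \<longlonglongrightarrow> 0"
    proof (rule Lim_null_comparison)
      show "\<forall>\<^sub>F n in sequentially. norm (r n) \<le> e * (1/2) ^ n"
        using r by (intro always_eventually allI less_imp_le) (simp add: field_simps)
      show "(\<lambda>n. e * (1/2) ^ n) \<longlonglongrightarrow> 0"
        by (intro tendsto_mult_right_zero LIMSEQ_realpow_zero) auto
    qed
    then have "(\<lambda>n. x - r n) \<longlonglongrightarrow> x"
      using tendsto_diff[OF tendsto_const, of r 0 sequentially x] by simp
    moreover have "(\<lambda>n. f (x - r n)) \<longlonglongrightarrow> suminf y"
      unfolding fx by (rule summable_LIMSEQ[OF summable_norm_cancel[OF yn]])
    \<comment> \<open>The closed graph enters only here: the partial sums tend to \<open>x\<close>
      and their images converge, so the limit of the images must be \<open>f x\<close>.\<close>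
    ultimately have "f x = suminf y" by (rule graph)
    also have "norm \<dots> \<le> (\<Sum>n. norm (y n))" by (rule summable_norm[OF yn])
    also have "\<dots> \<le> (\<Sum>n. k * (1/2) ^ n)" by (rule suminf_le[OF y yn sm])
    also have "\<dots> = 2 * k" by (subst suminf_mult) (auto simp: suminf_geometric summable_geometric)
    finally show ?thesis .
  qed
  \<comment> \<open>Rescaling \<open>x\<close> to norm \<open>e / 2\<close>, strictly inside the
    ball, doubles the factor \<open>2 * k / e\<close>.\<close>
  have "norm (f x) \<le> norm x * (4 * k / e)" for x
  proof (cases "x = 0")
    case False
    define c where "c = e / (2 * norm x)"
    have c: "0 < c" using False e by (simp add: c_def)
    have "norm (c *\<^sub>R x) < e" using False e by (simp add: c_def)
    from bound[OF this] c have "c * norm (f x) \<le> 2 * k" by (simp add: lin linear_scale)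
    with e False show ?thesis by (simp add: c_def field_simps)
  qed (simp add: lin linear_0)
  with lin show ?thesis
    by (intro bounded_linear_intro[of f "4 * k / e"]) (auto simp: linear_add linear_scale)
qed


section \<open>Inner products\<close>

lemma scaleC_scaleR_commute: "r *\<^sub>R a *\<^sub>C x = a *\<^sub>C r *\<^sub>R x" for x :: "'a::complex_vector"
  by (simp add: mult.commute scaleC_scaleC flip: scaleC_of_real)

lemma cinner_add_right: "cinner x (y + z) = cinner x y + cinner x z"
  by (metis cinner_add_left cinner_commute complex_cnj_add)

lemma cinner_scaleC_right: "cinner x (a *\<^sub>C y) = cnj a * cinner x y"
  by (metis cinner_commute cinner_scaleC_left complex_cnj_mult)

lemma cinner_scaleR_left: "cinner (r *\<^sub>R x) y = r *\<^sub>R cinner x y"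
  by (metis cinner_scaleC_left scaleC_of_real scaleR_conv_of_real)

lemma cinner_scaleR_right: "cinner x (r *\<^sub>R y) = r *\<^sub>R cinner x y"
  by (metis cinner_scaleC_right scaleC_of_real scaleR_conv_of_real complex_cnj_complex_of_real)

lemma cinner_zero_left [simp]: "cinner 0 y = 0"
  using cinner_add_left[of 0 0 y] by simp

lemma cinner_zero_right [simp]: "cinner x 0 = 0"
  using cinner_add_right[of x 0 0] by simp

lemma cinner_diff_left: "cinner (x - y) z = cinner x z - cinner y z"
  using cinner_add_left[of "x - y" y z] by simp

lemma cinner_diff_right: "cinner x (y - z) = cinner x y - cinner x z"
  using cinner_add_right[of x "y - z" z] by simp

lemma cinner_self_eq_0_iff [simp]: "cinner x x = 0 \<longleftrightarrow> x = 0"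
  by (simp add: cinner_self)

lemma cinner_eqI: "x = y" if "\<And>z. cinner x z = cinner y z"
  using that[of "x - y"] cinner_self_eq_0_iff[of "x - y"] by (simp add: cinner_diff_left)

lemma cinner_eqI': "x = y" if "\<And>z. cinner z x = cinner z y"
  by (rule cinner_eqI) (metis cinner_commute that)

lemma norm_scaleC: "norm (a *\<^sub>C x) = cmod a * norm x" for x :: "'a::complex_inner"
proof -
  have "cinner (a *\<^sub>C x) (a *\<^sub>C x) = (a * cnj a) * cinner x x"
    by (simp add: cinner_scaleC_left cinner_scaleC_right)
  then have "complex_of_real ((norm (a *\<^sub>C x))\<^sup>2) = of_real ((cmod a * norm x)\<^sup>2)"
    unfolding cinner_self complex_norm_square[symmetric] by (simp add: power_mult_distrib)
  then show ?thesis
    by (simp add: power2_eq_iff_nonneg del: of_real_power)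
qed

lemma norm_diff_square_cinner:
  "(norm (x - y))\<^sup>2 = (norm x)\<^sup>2 - 2 * Re (cinner x y) + (norm y)\<^sup>2" for x :: "'a::complex_inner"
proof -
  have "complex_of_real ((norm (x - y))\<^sup>2) = cinner x x - (cinner x y + cnj (cinner x y)) + cinner y y"
    unfolding cinner_self[symmetric]
    by (simp add: cinner_diff_left cinner_diff_right flip: cinner_commute)
  also have "\<dots> = of_real ((norm x)\<^sup>2 - 2 * Re (cinner x y) + (norm y)\<^sup>2)"
    by (simp add: cinner_self complex_add_cnj)
  finally show ?thesis by (simp only: of_real_eq_iff)
qed

lemma parallelogram:
  "(norm (x + y))\<^sup>2 + (norm (x - y))\<^sup>2 = 2 * (norm x)\<^sup>2 + 2 * (norm y)\<^sup>2" for x :: "'a::complex_inner"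
  using norm_diff_square_cinner[of x y] norm_diff_square_cinner[of x "- y"]
    cinner_scaleR_right[of x "-1" y] by simp

text \<open>Pythagoras for the component of \<open>x\<close> along \<open>y\<close>. It serves
  twice: nonnegativity of the left side is Cauchy-Schwarz, and the strict drop when
  \<open>cinner x y\<close> is nonzero shows that a nearest point has an orthogonal
  residual.\<close>

lemma norm_residual_square:
  fixes x y :: "'a::complex_inner"
  assumes "y \<noteq> 0"
  shows "(norm (x - (cinner x y / of_real ((norm y)\<^sup>2)) *\<^sub>C y))\<^sup>2 =
    (norm x)\<^sup>2 - (cmod (cinner x y))\<^sup>2 / (norm y)\<^sup>2"
proof -
  define c where "c = cinner x y"
  let ?t = "c / of_real ((norm y)\<^sup>2)"
  have "cinner x (?t *\<^sub>C y) = of_real ((cmod c)\<^sup>2 / (norm y)\<^sup>2)"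
    unfolding cinner_scaleC_right c_def[symmetric]
    by (simp add: complex_norm_square[of c, unfolded of_real_power])
  then have "Re (cinner x (?t *\<^sub>C y)) = (cmod c)\<^sup>2 / (norm y)\<^sup>2"
    by (simp only: Re_complex_of_real)
  moreover have "(norm (?t *\<^sub>C y))\<^sup>2 = (cmod c)\<^sup>2 / (norm y)\<^sup>2"
    using assms by (simp add: norm_scaleC norm_divide norm_mult power2_eq_square)
  ultimately show ?thesis
    by (simp only: norm_diff_square_cinner c_def[symmetric])
qed

lemma norm_cinner_le: "cmod (cinner x y) \<le> norm x * norm y"
proof (cases "y = 0")
  case False
  have "(cmod (cinner x y))\<^sup>2 / (norm y)\<^sup>2 \<le> (norm x)\<^sup>2"
    using norm_residual_square[OF False, of x] by (metis diff_ge_0_iff_ge zero_le_power2)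
  then have "(cmod (cinner x y))\<^sup>2 \<le> (norm x * norm y)\<^sup>2"
    using False by (simp add: divide_le_eq power_mult_distrib)
  then show ?thesis by (rule power2_le_imp_le) simp
qed simp

lemma bounded_bilinear_cinner: "bounded_bilinear (cinner :: 'a::complex_inner \<Rightarrow> 'a \<Rightarrow> complex)"
  by standard
    (use norm_cinner_le in \<open>auto intro!: exI[of _ 1] simp: cinner_add_left cinner_add_right
      cinner_scaleR_left cinner_scaleR_right\<close>)

lemmas bounded_linear_cinner_left = bounded_bilinear.bounded_linear_left[OF bounded_bilinear_cinner]


section \<open>Orthogonal and oblique projections\<close>

definition orthogonal_complement :: "'a::complex_inner set \<Rightarrow> 'a set"
  where "orthogonal_complement X = {h. \<forall>x\<in>X. cinner h x = 0}"

lemma orthogonal_complementD: "h \<in> orthogonal_complement X \<Longrightarrow> x \<in> X \<Longrightarrow> cinner h x = 0"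
  by (simp add: orthogonal_complement_def)

lemma closed_csubspace_orthogonal_complement:
  fixes X :: "'a::complex_inner set"
  shows "closed_csubspace (orthogonal_complement X)"
proof
  show "csubspace (orthogonal_complement X)"
    by (auto simp: complex_vector.subspace_def orthogonal_complement_def cinner_add_left
        cinner_scaleC_left)
  have "orthogonal_complement X = (\<Inter>x\<in>X. (\<lambda>h. cinner h x) -` {0})"
    by (auto simp: orthogonal_complement_def)
  also have "closed \<dots>"
    by (intro closed_INT ballI closed_vimage linear_continuous_on bounded_linear_cinner_left) auto
  finally show "closed (orthogonal_complement X)" .
qed

lemma csubspace_scaleR:
  assumes "csubspace X" "x \<in> X"
  shows "r *\<^sub>R x \<in> X"
  using complex_vector.subspace_scale[OF assms, of "of_real r"] by (simp add: scaleC_of_real)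

theorem direct_sum_orthogonal_complement:
  fixes X :: "'a::chilbert_space set"
  assumes X: "csubspace X" "closed X"
  shows "direct_sum_decomp X (orthogonal_complement X)"
  unfolding direct_sum_decomp_def
proof (intro conjI allI)
  show "X \<inter> orthogonal_complement X = {0}"
    using complex_vector.subspace_0[OF X(1)] by (auto simp: orthogonal_complement_def)
next
  fix h :: 'a
  have ne: "X \<noteq> {}" using complex_vector.subspace_0[OF X(1)] by blast
  define d where "d = infdist h X"
  have d: "0 \<le> d" "d \<le> norm (h - x)" if "x \<in> X" for x
    using infdist_le[OF that, of h] by (auto simp: d_def dist_norm infdist_nonneg)
  have "\<exists>x\<in>X. norm (h - x) < d + 1 / Suc n" for n
  proof -
    have "infdist h X < d + 1 / Suc n" by (simp add: d_def)
    then show ?thesis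
      unfolding infdist_notempty[OF ne] dist_norm[symmetric]
      by (subst (asm) cInf_less_iff) (use ne in \<open>auto intro: bdd_belowI2[of _ 0]\<close>)
  qed
  then obtain x where xX: "\<And>n. x n \<in> X" and xd: "\<And>n. norm (h - x n) < d + 1 / Suc n"
    by metis
  have normlim: "(\<lambda>n. norm (h - x n)) \<longlonglongrightarrow> d"
  proof (rule tendsto_sandwich[of "\<lambda>_. d" _ _ "\<lambda>n. d + 1 / Suc n"])
    show "(\<lambda>n. d + 1 / real (Suc n)) \<longlonglongrightarrow> d"
      using tendsto_add[OF tendsto_const[of d] lim_inverse_n'[THEN LIMSEQ_Suc]] by simp
  qed (use d xX xd in \<open>auto intro!: always_eventually less_imp_le\<close>)
  \<comment> \<open>Midpoints stay in \<open>X\<close>, hence at distance at least \<open>d\<close>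
    from \<open>h\<close>. The parallelogram law then bounds the squared distance of two terms by 4
    * (d^2 + e^2 / 4) - 4 * d^2 = e^2.\<close>
  have "Cauchy x"
  proof (rule metric_CauchyI)
    fix e :: real assume "0 < e"
    have "(\<lambda>n. (norm (h - x n))\<^sup>2) \<longlonglongrightarrow> d\<^sup>2" by (intro tendsto_power normlim)
    then have "\<forall>\<^sub>F n in sequentially. (norm (h - x n))\<^sup>2 < d\<^sup>2 + e\<^sup>2 / 4"
      by (rule order_tendstoD(2)) (use \<open>0 < e\<close> in auto)
    then obtain N where N: "\<And>n. N \<le> n \<Longrightarrow> (norm (h - x n))\<^sup>2 < d\<^sup>2 + e\<^sup>2 / 4"
      by (auto simp: eventually_sequentially)
    show "\<exists>N. \<forall>m\<ge>N. \<forall>n\<ge>N. dist (x m) (x n) < e"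
    proof (intro exI allI impI)
      fix m n assume mn: "N \<le> m" "N \<le> n"
      have "(1/2) *\<^sub>R (x m + x n) \<in> X"
        using X xX by (simp add: csubspace_scaleR complex_vector.subspace_add)
      then have "d \<le> norm (h - (1/2) *\<^sub>R (x m + x n))" by (rule d(2))
      moreover have "(h - x m) + (h - x n) = 2 *\<^sub>R (h - (1/2) *\<^sub>R (x m + x n))"
        by (simp add: scaleR_2 algebra_simps)
      ultimately have "2 * d \<le> norm ((h - x m) + (h - x n))" by simp
      then have "4 * d\<^sup>2 \<le> (norm ((h - x m) + (h - x n)))\<^sup>2"
        using power_mono[of "2 * d" _ 2] d(1)[OF xX] by fastforce
      then have "(norm ((h - x m) - (h - x n)))\<^sup>2 < e\<^sup>2"
        using parallelogram[of "h - x m" "h - x n"] N[OF mn(1)] N[OF mn(2)] by linarith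
      then have "norm ((h - x m) - (h - x n)) < e"
        using \<open>0 < e\<close> by (simp add: power_less_imp_less_base)
      then show "dist (x m) (x n) < e" by (simp add: dist_norm norm_minus_commute)
    qed
  qed
  then obtain p where p: "x \<longlonglongrightarrow> p"
    using Cauchy_convergent convergent_def by blast
  have pX: "p \<in> X" using closed_sequentially[OF X(2) xX p] .
  have nd: "norm (h - p) = d"
    by (rule LIMSEQ_unique[OF _ normlim]) (intro tendsto_intros p)
  have "h - p \<in> orthogonal_complement X"
    unfolding orthogonal_complement_def
  proof (clarify, rule ccontr)
    fix y assume y: "y \<in> X" and c0: "cinner (h - p) y \<noteq> 0"
    \<comment> \<open>The optimal coefficient along \<open>y\<close>: a nonzero inner product would
      put \<open>p + t *\<^sub>C y\<close> strictly closer to \<open>h\<close> than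
      \<open>p\<close>.\<close>
    define t where "t = cinner (h - p) y / of_real ((norm y)\<^sup>2)"
    have y0: "y \<noteq> 0" using c0 by auto
    have "p + t *\<^sub>C y \<in> X"
      using X pX y by (simp add: complex_vector.subspace_add complex_vector.subspace_scale)
    from d[OF this] have "(norm (h - p))\<^sup>2 \<le> (norm ((h - p) - t *\<^sub>C y))\<^sup>2"
      unfolding nd by (metis diff_diff_add power_mono)
    with norm_residual_square[OF y0, of "h - p"] have "(cmod (cinner (h - p) y))\<^sup>2 / (norm y)\<^sup>2 \<le> 0"
      unfolding t_def by linarith
    with y0 c0 show False by (simp add: divide_le_0_iff)
  qed
  with pX show "\<exists>x\<in>X. \<exists>z\<in>orthogonal_complement X. h = x + z"
    by (intro bexI[of _ p] bexI[of _ "h - p"]) auto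
qed


section \<open>Bounded operators, adjoints and Moore-Penrose inverses\<close>

text \<open>The bridge to \<open>bounded_linear\<close>, which is real linear: continuity, limits
  and series come from there, and only complex homogeneity is carried separately.\<close>

lemma bounded_clinear_iff:
  "bounded_clinear A \<longleftrightarrow> bounded_linear A \<and> (\<forall>c x. A (c *\<^sub>C x) = c *\<^sub>C A x)"
proof
  assume A: "bounded_clinear A"
  then have add: "A (x + y) = A x + A y" and scale: "A (c *\<^sub>C x) = c *\<^sub>C A x" for x y c
    by (simp_all add: bounded_clinear_def Vector_Spaces.linear_iff)
  from A obtain K where K: "\<And>x. norm (A x) \<le> norm x * K"
    unfolding bounded_clinear_def by blast
  have "A (r *\<^sub>R x) = r *\<^sub>R A x" for r x
    using scale[of "of_real r" x] by (simp only: scaleC_of_real)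
  with add K have "bounded_linear A" by (intro bounded_linear_intro)
  with scale show "bounded_linear A \<and> (\<forall>c x. A (c *\<^sub>C x) = c *\<^sub>C A x)" by blast
next
  assume A: "bounded_linear A \<and> (\<forall>c x. A (c *\<^sub>C x) = c *\<^sub>C A x)"
  then show "bounded_clinear A"
    using bounded_linear.bounded[of A] bounded_linear.linear[of A]
    by (auto simp: bounded_clinear_def Vector_Spaces.linear_iff linear_add
        complex_vector.vector_space_axioms)
qed

lemma bounded_clinear_imp_bounded_linear: "bounded_clinear A \<Longrightarrow> bounded_linear A"
  and bounded_clinear_scaleC: "bounded_clinear A \<Longrightarrow> A (c *\<^sub>C x) = c *\<^sub>C A x"
  by (simp_all add: bounded_clinear_iff)

lemma linear_if_add_scaleC:
  assumes "\<And>x y. A (x + y) = A x + A y" "\<And>c x. A (c *\<^sub>C x) = c *\<^sub>C A x"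
  shows "linear A"
  using assms(1) assms(2)[of "of_real r" for r] by (intro linearI) (simp_all add: scaleC_of_real)

lemma closed_csubspace_ker:
  assumes "bounded_clinear A"
  shows "closed_csubspace (ker A)"
proof
  interpret A: bounded_linear A using assms by (rule bounded_clinear_imp_bounded_linear)
  show "csubspace (ker A)"
    by (auto simp: complex_vector.subspace_def ker_def A.zero A.add bounded_clinear_scaleC[OF assms])
  have "ker A = A -` {0}" by (auto simp: ker_def)
  also have "closed \<dots>"
    by (intro closed_vimage linear_continuous_on A.bounded_linear_axioms) auto
  finally show "closed (ker A)" .
qed

lemma csubspace_range: "csubspace (range A)" if A: "bounded_clinear A"
proof -
  interpret A: bounded_linear A using A by (rule bounded_clinear_imp_bounded_linear)
  show ?thesis
    unfolding complex_vector.subspace_def image_iff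
    by (auto simp flip: A.add bounded_clinear_scaleC[OF A] intro: A.zero exI[of _ 0])
qed

section \<open>Oblique projections: algebra first, then boundedness\<close>

locale oblique_decomp =
  fixes X Z :: "'a::complex_vector set"
  assumes X: "csubspace X" and Z: "csubspace Z" and decomp: "direct_sum_decomp X Z"
begin

lemma unique:
  assumes "x \<in> X" "y \<in> X" "x - y \<in> Z"
  shows "x = y"
proof -
  have "x - y \<in> X \<inter> Z" using complex_vector.subspace_diff[OF X assms(1,2)] assms(3) by blast
  then have "x - y = 0" using decomp unfolding direct_sum_decomp_def by blast
  then show ?thesis by simp
qed

lemma proj_eqI:
  assumes "x \<in> X" "h - x \<in> Z"
  shows "oblique_proj X Z h = x"
  unfolding oblique_proj_def
proof (rule the_equality)
  show "x \<in> X \<and> (\<exists>z\<in>Z. h = x + z)"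
    using assms by (metis add.commute diff_add_cancel)
next
  fix y assume y: "y \<in> X \<and> (\<exists>z\<in>Z. h = y + z)"
  then have "h - y \<in> Z" by auto
  from complex_vector.subspace_diff[OF Z assms(2) this] show "y = x"
    using y assms by (intro unique) auto
qed

lemma proj_in: "oblique_proj X Z h \<in> X" and proj_residual: "h - oblique_proj X Z h \<in> Z"
proof -
  obtain x z where "x \<in> X" "z \<in> Z" "h = x + z"
    using decomp unfolding direct_sum_decomp_def by metis
  moreover from this have "oblique_proj X Z h = x" by (intro proj_eqI) auto
  ultimately show "oblique_proj X Z h \<in> X" "h - oblique_proj X Z h \<in> Z" by auto
qed

lemma proj_fix: "x \<in> X \<Longrightarrow> oblique_proj X Z x = x"
  by (rule proj_eqI) (auto simp: complex_vector.subspace_0[OF Z])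

lemma proj_0_iff: "oblique_proj X Z h = 0 \<longleftrightarrow> h \<in> Z"
  using proj_residual[of h] proj_eqI[of 0 h] complex_vector.subspace_0[OF X] by auto

lemma proj_add: "oblique_proj X Z (g + h) = oblique_proj X Z g + oblique_proj X Z h"
  using complex_vector.subspace_add[OF Z proj_residual proj_residual, of g h]
  by (intro proj_eqI complex_vector.subspace_add[OF X] proj_in) (simp add: algebra_simps)

lemma proj_scaleC: "oblique_proj X Z (c *\<^sub>C h) = c *\<^sub>C oblique_proj X Z h"
  using complex_vector.subspace_scale[OF Z proj_residual, of c h]
  by (intro proj_eqI complex_vector.subspace_scale[OF X] proj_in)
    (simp add: complex_vector.scale_right_diff_distrib)

end

lemma bounded_clinear_oblique_proj:
  fixes X :: "'a::chilbert_space set"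
  assumes "closed_csubspace X" "closed_csubspace Z" "direct_sum_decomp X Z"
  shows "bounded_clinear (oblique_proj X Z)"
proof -
  interpret oblique_decomp X Z using assms by unfold_locales auto
  have "bounded_linear (oblique_proj X Z)"
  proof (rule closed_graph_bounded_linear)
    show "linear (oblique_proj X Z)"
      by (rule linear_if_add_scaleC) (simp_all add: proj_add proj_scaleC)
    \<comment> \<open>Closedness of both summands closes the graph: the limit of the projections
      lies in \<open>X\<close>, the limit of the residuals in \<open>Z\<close>, and this pair
      determines the projection.\<close>
    fix u x y assume u: "u \<longlonglongrightarrow> x" and y: "(\<lambda>n. oblique_proj X Z (u n)) \<longlonglongrightarrow> y"
    have "(\<lambda>n. u n - oblique_proj X Z (u n)) \<longlonglongrightarrow> x - y" by (intro tendsto_diff u y)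
    with assms(2) have "x - y \<in> Z" by (intro closed_sequentially[OF _ proj_residual]) auto
    moreover from assms(1) y have "y \<in> X" by (intro closed_sequentially[OF _ proj_in]) auto
    ultimately show "oblique_proj X Z x = y" by (intro proj_eqI)
  qed
  then show ?thesis by (simp add: bounded_clinear_iff proj_scaleC)
qed

lemma oblique_decomp_orthogonal:
  fixes X :: "'a::chilbert_space set"
  assumes "closed_csubspace X"
  shows "oblique_decomp X (orthogonal_complement X)"
  using assms closed_csubspace_orthogonal_complement[of X]
  by unfold_locales (auto intro: direct_sum_orthogonal_complement)

lemma cinner_orthogonal_proj:
  fixes X :: "'a::chilbert_space set"
  assumes "closed_csubspace X" "y \<in> X"
  shows "cinner (oblique_proj X (orthogonal_complement X) x) y = cinner x y"
  using orthogonal_complementD[OF oblique_decomp.proj_residual[OF oblique_decomp_orthogonal[OF assms(1)]]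
      assms(2), of x] by (simp add: cinner_diff_left)

lemma is_adjoint_orthogonal_proj:
  fixes X :: "'a::chilbert_space set"
  assumes X: "closed_csubspace X"
  defines "p \<equiv> oblique_proj X (orthogonal_complement X)"
  shows "is_adjoint p p"
proof -
  have pX: "p x \<in> X" for x
    unfolding p_def by (rule oblique_decomp.proj_in[OF oblique_decomp_orthogonal[OF X]])
  have 1: "cinner (p x) (p y) = cinner x (p y)" for x y
    unfolding p_def by (rule cinner_orthogonal_proj[OF X pX[unfolded p_def]])
  have "cinner (p x) y = cinner x (p y)" for x y
    using 1[of x y] 1[of y x] cinner_commute[of "p x" "p y"] cinner_commute[of "p x" y] by simp
  then show ?thesis by (simp add: is_adjoint_def)
qed

section \<open>Riesz representation and adjoints\<close>

theorem riesz_representation: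
  fixes f :: "'a::chilbert_space \<Rightarrow> complex"
  assumes f: "bounded_clinear f"
  shows "\<exists>v. \<forall>x. f x = cinner x v"
proof (cases "ker f = UNIV")
  case True
  then show ?thesis by (auto simp: ker_def set_eq_iff intro: exI[of _ 0])
next
  case False
  interpret f: bounded_linear f using f by (rule bounded_clinear_imp_bounded_linear)
  note K = closed_csubspace_ker[OF f]
  interpret oblique_decomp "ker f" "orthogonal_complement (ker f)"
    by (rule oblique_decomp_orthogonal[OF K])
  obtain h where "f h \<noteq> 0" using False by (auto simp: ker_def)
  define w where "w = h - oblique_proj (ker f) (orthogonal_complement (ker f)) h"
  have w: "w \<in> orthogonal_complement (ker f)" unfolding w_def by (rule proj_residual)
  have fw: "f w \<noteq> 0"
    using proj_in[of h] \<open>f h \<noteq> 0\<close> by (simp add: w_def f.diff ker_def)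
  then have w0: "w \<noteq> 0" using f.zero by auto
  \<comment> \<open>\<open>w\<close> is orthogonal to the kernel with \<open>f w\<close> nonzero.
    Subtracting from \<open>x\<close> the multiple of \<open>w\<close> with the same value under
    \<open>f\<close> lands in the kernel, and pairing with \<open>w\<close> then reads off
    \<open>f x\<close>.\<close>
  have "f x = cinner x ((cnj (f w) / cinner w w) *\<^sub>C w)" for x
  proof -
    have "x - (f x / f w) *\<^sub>C w \<in> ker f"
      using fw by (simp add: ker_def f.diff bounded_clinear_scaleC[OF f] scaleC_complex_def)
    from orthogonal_complementD[OF w this] have "cinner (x - (f x / f w) *\<^sub>C w) w = 0"
      by (metis cinner_commute complex_cnj_zero)
    then have "cinner x w = f x / f w * cinner w w"
      by (simp add: cinner_diff_left cinner_scaleC_left)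
    with fw w0 show ?thesis
      by (simp add: cinner_scaleC_right flip: cinner_commute)
  qed
  then show ?thesis by blast
qed

lemma is_adjoint_cadjoint:
  fixes A :: "'a::chilbert_space \<Rightarrow> 'b::chilbert_space"
  assumes A: "bounded_clinear A"
  shows "is_adjoint A (cadjoint A)"
  unfolding cadjoint_def
proof (rule theI'[where P = "is_adjoint A"])
  have "bounded_clinear (\<lambda>x. cinner (A x) y)" for y
    using A by (auto simp: bounded_clinear_iff cinner_scaleC_left scaleC_complex_def
        intro: bounded_linear_compose[OF bounded_linear_cinner_left])
  then have "\<forall>y. \<exists>v. \<forall>x. cinner (A x) y = cinner x v"
    by (intro allI riesz_representation)
  then have "\<exists>B. \<forall>y x. cinner (A x) y = cinner x (B y)"
    by (rule choice)
  then have ex: "\<exists>B. is_adjoint A B"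
    by (auto simp: is_adjoint_def)
  have uniq: "B = C" if "is_adjoint A B" "is_adjoint A C" for B C
  proof (rule ext)
    fix y
    show "B y = C y"
      by (rule cinner_eqI') (use that in \<open>simp add: is_adjoint_def\<close>)
  qed
  show "\<exists>!B. is_adjoint A B"
    using ex uniq by (rule ex_ex1I)
qed

lemma is_adjoint_sym: "is_adjoint A B \<Longrightarrow> is_adjoint B A"
  unfolding is_adjoint_def by (metis cinner_commute)

text \<open>From norm (B y)^2 = <A (B y), y>. No linearity of \<open>B\<close> enters, so the bound
  applies directly to a described adjoint.\<close>

lemma is_adjoint_bound:
  assumes "is_adjoint A B" "bounded_clinear A"
  shows "\<exists>K. \<forall>y. norm (B y) \<le> norm y * K"
proof -
  obtain K where K: "0 < K" "norm (A x) \<le> norm x * K" for x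
    using bounded_linear.pos_bounded[OF bounded_clinear_imp_bounded_linear[OF assms(2)]] by blast
  have "norm (B y) \<le> norm y * K" for y
  proof (cases "B y = 0")
    case False
    have "(norm (B y))\<^sup>2 = cmod (cinner (B y) (B y))" by (simp add: cinner_self norm_power)
    also have "\<dots> = cmod (cinner (A (B y)) y)" using assms(1) by (simp add: is_adjoint_def)
    also have "\<dots> \<le> norm (A (B y)) * norm y" by (rule norm_cinner_le)
    also have "\<dots> \<le> (norm (B y) * K) * norm y" by (intro mult_right_mono K(2)) simp
    finally show ?thesis using False by (simp add: power2_eq_square mult.assoc mult.commute)
  qed (use K(1) in simp)
  then show ?thesis by blast
qed

section \<open>Moore-Penrose inverses\<close>

lemma is_moore_penrose_unique:
  assumes B: "is_moore_penrose A B" and C: "is_moore_penrose A C"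
  shows "B = C"
proof -
  have AB: "A (B (A x)) = A x" "B (A (B y)) = B y" and AC: "A (C (A x)) = A x" "C (A (C y)) = C y" for x y
    using B C by (auto simp: is_moore_penrose_def fun_eq_iff)
  have adj: "cinner (A (B x)) y = cinner x (A (B y))" "cinner (A (C x)) y = cinner x (A (C y))"
    "cinner (B (A u)) v = cinner u (B (A v))" "cinner (C (A u)) v = cinner u (C (A v))" for x y u v
    using B C by (auto simp: is_moore_penrose_def is_adjoint_def)
  \<comment> \<open>AB = (AC)(AB), and all three of these operators that matter are handled by
    moving the self-adjoint factors across: (AB)(AC) = (ABA)C = AC. The same argument for BA and CA
    then gives B = BAB = BAC = CAC = C.\<close>
  have "A (B x) = A (C x)" for x
  proof (rule cinner_eqI)
    fix y
    have "cinner (A (B x)) y = cinner (A (C (A (B x)))) y" by (simp add: AC)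
    also have "\<dots> = cinner x (A (B (A (C y))))" by (simp only: adj)
    also have "\<dots> = cinner (A (C x)) y" by (simp add: AB adj)
    finally show "cinner (A (B x)) y = cinner (A (C x)) y" .
  qed
  moreover have "B (A x) = C (A x)" for x
  proof (rule cinner_eqI)
    fix y
    have "cinner (B (A x)) y = cinner (B (A (C (A x)))) y" by (simp add: AC)
    also have "\<dots> = cinner x (C (A (B (A y))))" by (simp only: adj)
    also have "\<dots> = cinner (C (A x)) y" by (simp add: AB adj)
    finally show "cinner (B (A x)) y = cinner (C (A x)) y" .
  qed
  ultimately have "B x = C x" for x using AB(2)[of x] AC(2)[of x] by metis
  then show "B = C" by (rule ext)
qed

lemma closed_range_moore_penrose_exists:
  fixes A :: "'a::chilbert_space \<Rightarrow> 'b::chilbert_space"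
  assumes A: "bounded_clinear A" and cl: "closed (range A)"
  shows "\<exists>B. is_moore_penrose A B"
proof -
  interpret A: bounded_linear A using A by (rule bounded_clinear_imp_bounded_linear)
  define N where "N = orthogonal_complement (ker A)"
  define k where "k = oblique_proj (ker A) N"
  define p where "p = oblique_proj (range A) (orthogonal_complement (range A))"
  note K = closed_csubspace_ker[OF A]
  have R: "closed_csubspace (range A)" using cl csubspace_range[OF A] by blast
  have N: "closed_csubspace N" unfolding N_def by (rule closed_csubspace_orthogonal_complement)
  interpret K: oblique_decomp "ker A" N unfolding N_def by (rule oblique_decomp_orthogonal[OF K])
  interpret R: oblique_decomp "range A" "orthogonal_complement (range A)"
    by (rule oblique_decomp_orthogonal[OF R])
  have p: "bounded_clinear p" unfolding p_def
    using R closed_csubspace_orthogonal_complement R.decomp by (rule bounded_clinear_oblique_proj)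
  have Ak: "A (k x) = 0" for x using K.proj_in[of x] by (simp add: k_def ker_def)
  have inj: "x = y" if "x \<in> N" "y \<in> N" "A x = A y" for x y
  proof -
    have "x - y \<in> N" using N that by (simp add: complex_vector.subspace_diff)
    moreover have "x - y \<in> ker A" using that by (simp add: ker_def A.diff)
    ultimately show ?thesis
      unfolding N_def using orthogonal_complementD[of "x - y" "ker A" "x - y"] by simp
  qed
  \<comment> \<open>The inverse is built by hand: project \<open>y\<close> onto the closed range,
    then take the unique preimage orthogonal to the kernel. So \<open>A \<circ> B\<close> is the
    orthogonal projection onto the range and \<open>B \<circ> A\<close> the one onto
    \<open>N\<close>, whence the four Penrose equations.\<close>
  have "\<exists>x\<in>N. A x = p y" for y
  proof -
    obtain x where "p y = A x" using R.proj_in[of y] unfolding p_def by auto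
    moreover have "A (x - k x) = A x" by (simp add: A.diff Ak)
    ultimately show ?thesis using K.proj_residual[of x] unfolding k_def by metis
  qed
  then obtain B where BN: "\<And>y. B y \<in> N" and AB: "\<And>y. A (B y) = p y" by metis
  have B_eqI: "B y = x" if "x \<in> N" "A x = p y" for x y
    using inj[OF BN that(1)] AB that(2) by simp
  have BA: "B (A x) = x - k x" for x
    using K.proj_residual[of x]
    by (intro B_eqI) (auto simp: A.diff Ak p_def R.proj_fix k_def[symmetric])
  interpret p: bounded_linear p using p by (rule bounded_clinear_imp_bounded_linear)
  have B_add: "B (x + y) = B x + B y" for x y
    using N BN by (intro B_eqI) (auto simp: complex_vector.subspace_add A.add AB p.add)
  have B_scale: "B (c *\<^sub>C x) = c *\<^sub>C B x" for c x
    using N BN by (intro B_eqI)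
      (auto simp: complex_vector.subspace_scale AB bounded_clinear_scaleC A p)
  have "bounded_linear B"
  proof (rule closed_graph_bounded_linear)
    show "linear B" using B_add B_scale by (rule linear_if_add_scaleC)
    \<comment> \<open>Closed graph again: continuity of \<open>A\<close> and \<open>p\<close> gives
      \<open>A b = p y\<close>, and \<open>b\<close> stays in the closed set \<open>N\<close>, which
      characterizes \<open>B y\<close>.\<close>
    fix u y b assume u: "u \<longlonglongrightarrow> y" and b: "(\<lambda>n. B (u n)) \<longlonglongrightarrow> b"
    have "(\<lambda>n. A (B (u n))) \<longlonglongrightarrow> A b" by (intro A.tendsto b)
    moreover have "(\<lambda>n. A (B (u n))) \<longlonglongrightarrow> p y" unfolding AB by (intro p.tendsto u)
    ultimately have "A b = p y" by (rule LIMSEQ_unique)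
    moreover have "b \<in> N" by (rule closed_sequentially[OF conjunct2[OF N] BN b])
    ultimately show "B y = b" by (intro B_eqI)
  qed
  then have "bounded_clinear B" by (simp add: bounded_clinear_iff B_scale)
  moreover have "A \<circ> B \<circ> A = A" by (simp add: fun_eq_iff AB p_def R.proj_fix)
  moreover have "B \<circ> A \<circ> B = B"
  proof -
    have "k (B y) = 0" for y unfolding k_def by (simp add: K.proj_0_iff BN)
    then show ?thesis by (simp add: fun_eq_iff BA)
  qed
  moreover have "is_adjoint (A \<circ> B) (A \<circ> B)"
    using is_adjoint_orthogonal_proj[OF R] by (simp add: is_adjoint_def AB p_def)
  moreover have "is_adjoint (B \<circ> A) (B \<circ> A)"
    using is_adjoint_orthogonal_proj[OF K, folded N_def]
    by (simp add: is_adjoint_def BA k_def cinner_diff_left cinner_diff_right)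
  ultimately show ?thesis unfolding is_moore_penrose_def by blast
qed

lemma is_moore_penrose_moore_penrose:
  fixes A :: "'a::chilbert_space \<Rightarrow> 'b::chilbert_space"
  assumes "bounded_clinear A" "closed (range A)"
  shows "is_moore_penrose A (moore_penrose A)"
  unfolding moore_penrose_def
proof (rule theI'[where P = "is_moore_penrose A"])
  show "\<exists>!B. is_moore_penrose A B"
    using closed_range_moore_penrose_exists[OF assms] is_moore_penrose_unique by blast
qed

section \<open>Closed range and lower bounds off the kernel\<close>

lemma bounded_below_if_closed_range:
  fixes A :: "'a::chilbert_space \<Rightarrow> 'b::chilbert_space"
  assumes A: "bounded_clinear A" and cl: "closed (range A)"
  shows "\<exists>c. \<forall>h\<in>orthogonal_complement (ker A). norm h \<le> norm (A h) * c"
proof -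
  obtain B where B: "is_moore_penrose A B"
    using closed_range_moore_penrose_exists[OF assms] by blast
  then obtain c where c: "norm (B y) \<le> norm y * c" for y
    by (auto simp: is_moore_penrose_def bounded_clinear_def)
  interpret A: bounded_linear A using A by (rule bounded_clinear_imp_bounded_linear)
  have "norm h \<le> norm (A h) * c" if h: "h \<in> orthogonal_complement (ker A)" for h
  proof -
    \<comment> \<open>The difference lies in the kernel, hence is orthogonal to \<open>h\<close>; it
      is also orthogonal to \<open>B (A h)\<close> because \<open>B \<circ> A\<close> is a
      self-adjoint idempotent. So it vanishes, and the bound of \<open>B\<close> becomes the lower
      bound of \<open>A\<close>.\<close>
    have "h - B (A h) \<in> ker A"
      using B by (simp add: ker_def A.diff is_moore_penrose_def fun_eq_iff)
    moreover have "cinner (B (A h)) (h - B (A h)) = 0"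
      using B by (simp add: is_moore_penrose_def is_adjoint_def fun_eq_iff cinner_diff_right)
    ultimately have "cinner (h - B (A h)) (h - B (A h)) = 0"
      using orthogonal_complementD[OF h] by (simp add: cinner_diff_left)
    then have "h = B (A h)" by simp
    with c show ?thesis by metis
  qed
  then show ?thesis by blast
qed

lemma closed_range_if_bounded_below:
  fixes A :: "'a::chilbert_space \<Rightarrow> 'b::chilbert_space"
  assumes A: "bounded_clinear A"
    and c: "\<And>h. h \<in> orthogonal_complement (ker A) \<Longrightarrow> norm h \<le> norm (A h) * c"
  shows "closed (range A)"
proof -
  define N where "N = orthogonal_complement (ker A)"
  interpret A: bounded_linear A using A by (rule bounded_clinear_imp_bounded_linear)
  note K = closed_csubspace_ker[OF A]
  interpret K: oblique_decomp "ker A" N unfolding N_def by (rule oblique_decomp_orthogonal[OF K])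
  have N: "closed_csubspace N" unfolding N_def by (rule closed_csubspace_orthogonal_complement)
  have "complete (A ` N)"
  proof (rule complete_isometric_image)
    \<comment> \<open>The sign of \<open>c\<close> is unknown, and the completeness lemma needs a
      positive constant.\<close>
    show "0 < 1 / (\<bar>c\<bar> + 1)" by simp
    show "subspace N" using N
      by (auto simp: subspace_def complex_vector.subspace_0 complex_vector.subspace_add csubspace_scaleR)
    show "\<forall>x\<in>N. 1 / (\<bar>c\<bar> + 1) * norm x \<le> norm (A x)"
    proof
      fix x assume "x \<in> N"
      then have "norm x \<le> norm (A x) * c" unfolding N_def by (rule c)
      also have "\<dots> \<le> norm (A x) * (\<bar>c\<bar> + 1)" by (intro mult_left_mono) auto
      finally show "1 / (\<bar>c\<bar> + 1) * norm x \<le> norm (A x)" by (simp add: field_simps)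
    qed
    show "complete N" using N by (simp add: complete_eq_closed)
  qed (rule A.bounded_linear_axioms)
  moreover have "range A = A ` N"
  proof -
    have "A x \<in> A ` N" for x
    proof -
      have "A x = A (x - oblique_proj (ker A) N x)"
        using K.proj_in[of x] by (simp add: A.diff ker_def)
      then show ?thesis using K.proj_residual by blast
    qed
    then show ?thesis by blast
  qed
  ultimately show ?thesis by (simp add: complete_eq_closed)
qed

text \<open>Taking adjoints in (AB)A = A and A(BA) = A gives A(AB) = A and (BA)A = A, so AB = BAAB =
  BA. Self-adjointness of B follows by moving these commuting projections across the inner
  product.\<close>

lemma self_adjoint_moore_penrose:
  assumes A: "is_adjoint A A" and B: "is_moore_penrose A B"
  shows moore_penrose_commute: "A (B x) = B (A x)"
    and is_adjoint_moore_penrose: "is_adjoint B B"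
proof -
  have AB: "A (B (A x)) = A x" "B (A (B x)) = B x" for x
    using B by (auto simp: is_moore_penrose_def fun_eq_iff)
  have adj: "cinner (A x) y = cinner x (A y)" "cinner (A (B x)) y = cinner x (A (B y))"
    "cinner (B (A x)) y = cinner x (B (A y))" for x y
    using A B by (auto simp: is_moore_penrose_def is_adjoint_def)
  have "A x = A (A (B x))" for x
  proof (rule cinner_eqI)
    fix y
    show "cinner (A x) y = cinner (A (A (B x))) y"
      using adj(1)[of x "A (B y)"] adj(2)[of "A x" y] adj(1)[of "A (B x)" y] adj(2)[of x "A y"]
        adj(1)[of x y] AB(1)[of x] AB(1)[of y] by simp
  qed
  moreover have "B (A (A x)) = A x" for x
  proof (rule cinner_eqI)
    fix y
    show "cinner (B (A (A x))) y = cinner (A x) y"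
      using adj(3)[of "A x" y] adj(1)[of x "B (A y)"] adj(1)[of x y] AB(1)[of y] by simp
  qed
  ultimately show comm: "A (B x) = B (A x)" for x by metis
  have "cinner (B x) y = cinner x (B y)" for x y
  proof -
    have "cinner (B x) y = cinner (B (A (B x))) y" by (simp add: AB)
    also have "\<dots> = cinner (B x) (A (B y))"
      using adj(3)[of "B x" y] comm[of y] by simp
    also have "\<dots> = cinner (A (B x)) (B y)" using adj(1)[of "B x" "B y"] by simp
    also have "\<dots> = cinner x (B y)" using adj(2)[of x "B y"] comm[of "B y"] AB(2)[of y] by simp
    finally show ?thesis .
  qed
  then show "is_adjoint B B" by (simp add: is_adjoint_def)
qed


section \<open>Bessel sequences\<close>

lemma bessel_seq_obtain:
  assumes "bessel_seq f"
  obtains B where "0 < B" "\<And>h. summable (\<lambda>n. (cmod (cinner h (f n)))\<^sup>2)"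
    "\<And>h. (\<Sum>n. (cmod (cinner h (f n)))\<^sup>2) \<le> B * (norm h)\<^sup>2"
  using assms unfolding bessel_seq_def by blast

text \<open>The Bessel bound passes from analysis to synthesis by duality: pair the finite sum v
  with itself, apply Cauchy-Schwarz to the coefficients, and bound the analysis part by B * norm
  v^2. One factor norm v^2 then cancels.\<close>

lemma bessel_norm_sum_le:
  assumes "bessel_seq f"
  shows "\<exists>B>0. \<forall>c A. finite A \<longrightarrow>
    (norm (\<Sum>n\<in>A. c n *\<^sub>C f n))\<^sup>2 \<le> B * (\<Sum>n\<in>A. (cmod (c n))\<^sup>2)"
proof -
  obtain B where B: "0 < B" "\<And>h. summable (\<lambda>n. (cmod (cinner h (f n)))\<^sup>2)"
    "\<And>h. (\<Sum>n. (cmod (cinner h (f n)))\<^sup>2) \<le> B * (norm h)\<^sup>2"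
    using bessel_seq_obtain[OF assms] by metis
  have "(norm (\<Sum>n\<in>A. c n *\<^sub>C f n))\<^sup>2 \<le> B * (\<Sum>n\<in>A. (cmod (c n))\<^sup>2)" if A: "finite A" for c A
  proof -
    define v where "v = (\<Sum>n\<in>A. c n *\<^sub>C f n)"
    define a where "a = (\<Sum>n\<in>A. (cmod (c n))\<^sup>2)"
    define b where "b = (\<Sum>n\<in>A. (cmod (cinner v (f n)))\<^sup>2)"
    have "b \<le> (\<Sum>n. (cmod (cinner v (f n)))\<^sup>2)"
      unfolding b_def by (rule sum_le_suminf[OF B(2) A]) simp
    also have "\<dots> \<le> B * (norm v)\<^sup>2" by (rule B(3))
    finally have b: "b \<le> B * (norm v)\<^sup>2" .
    have "(norm v)\<^sup>2 = cmod (cinner v v)" by (simp add: cinner_self norm_power)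
    also have "cinner v v = (\<Sum>n\<in>A. c n * cinner (f n) v)"
      by (subst (1) v_def)
        (simp add: bounded_bilinear.sum_left[OF bounded_bilinear_cinner] cinner_scaleC_left)
    also have "cmod \<dots> \<le> (\<Sum>n\<in>A. \<bar>cmod (c n)\<bar> * \<bar>cmod (cinner v (f n))\<bar>)"
    proof (rule sum_norm_le)
      fix n
      have "cmod (cinner (f n) v) = cmod (cinner v (f n))"
        by (metis cinner_commute complex_mod_cnj)
      then show "cmod (c n * cinner (f n) v) \<le> \<bar>cmod (c n)\<bar> * \<bar>cmod (cinner v (f n))\<bar>"
        by (simp add: norm_mult)
    qed
    also have "\<dots> \<le> sqrt a * sqrt b"
      using L2_set_mult_ineq[of "\<lambda>n. cmod (c n)" "\<lambda>n. cmod (cinner v (f n))" A]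
      by (simp only: L2_set_def a_def b_def)
    finally have "((norm v)\<^sup>2)\<^sup>2 \<le> (sqrt a * sqrt b)\<^sup>2"
      by (rule power_mono) simp
    also have "\<dots> = a * b"
      by (simp add: power_mult_distrib a_def b_def sum_nonneg)
    also have "\<dots> \<le> a * (B * (norm v)\<^sup>2)"
      by (intro mult_left_mono b) (simp add: a_def sum_nonneg)
    finally have "(norm v)\<^sup>2 * (norm v)\<^sup>2 \<le> (B * a) * (norm v)\<^sup>2"
      by (simp add: power2_eq_square mult_ac)
    then have "(norm v)\<^sup>2 \<le> B * a" if "v \<noteq> 0"
      by (rule mult_right_le_imp_le) (use that in simp)
    moreover have "0 \<le> B * a" using B(1) by (simp add: a_def sum_nonneg)
    ultimately show ?thesis unfolding v_def[symmetric] a_def[symmetric] by fastforce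
  qed
  with B(1) show ?thesis by blast
qed

lemma bessel_synthesis:
  fixes f :: "nat \<Rightarrow> 'a::chilbert_space"
  assumes "bessel_seq f"
  shows bessel_summable: "summable (\<lambda>n. (cmod (c n))\<^sup>2) \<Longrightarrow> summable (\<lambda>n. c n *\<^sub>C f n)"
    and bessel_norm_suminf_le: "\<exists>B>0. \<forall>c. summable (\<lambda>n. (cmod (c n))\<^sup>2) \<longrightarrow>
      (norm (\<Sum>n. c n *\<^sub>C f n))\<^sup>2 \<le> B * (\<Sum>n. (cmod (c n))\<^sup>2)"
proof -
  obtain B where B: "0 < B" and le: "\<And>c A. finite A \<Longrightarrow>
      (norm (\<Sum>n\<in>A. c n *\<^sub>C f n))\<^sup>2 \<le> B * (\<Sum>n\<in>A. (cmod (c n))\<^sup>2)"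
    using bessel_norm_sum_le[OF assms] by blast
  have sm: "summable (\<lambda>n. c n *\<^sub>C f n)" if c: "summable (\<lambda>n. (cmod (c n))\<^sup>2)" for c
    unfolding summable_Cauchy
  proof (intro allI impI)
    fix e :: real assume "0 < e"
    then have "0 < e\<^sup>2 / B" using B by simp
    then obtain N where N: "\<And>m n. N \<le> m \<Longrightarrow> norm (\<Sum>k\<in>{m..<n}. (cmod (c k))\<^sup>2) < e\<^sup>2 / B"
      using c[unfolded summable_Cauchy] by blast
    have "norm (\<Sum>k\<in>{m..<n}. c k *\<^sub>C f k) < e" if "N \<le> m" for m n
    proof -
      have "(norm (\<Sum>k\<in>{m..<n}. c k *\<^sub>C f k))\<^sup>2 \<le> B * (\<Sum>k\<in>{m..<n}. (cmod (c k))\<^sup>2)"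
        by (rule le) simp
      also have "\<dots> < e\<^sup>2"
        using N[OF that, of n] B by (simp add: sum_nonneg field_simps)
      finally show ?thesis using \<open>0 < e\<close> by (simp add: power_less_imp_less_base)
    qed
    then show "\<exists>N. \<forall>m\<ge>N. \<forall>n. norm (\<Sum>k\<in>{m..<n}. c k *\<^sub>C f k) < e" by blast
  qed
  then show "summable (\<lambda>n. (cmod (c n))\<^sup>2) \<Longrightarrow> summable (\<lambda>n. c n *\<^sub>C f n)" .
  have "(norm (\<Sum>n. c n *\<^sub>C f n))\<^sup>2 \<le> B * (\<Sum>n. (cmod (c n))\<^sup>2)"
    if c: "summable (\<lambda>n. (cmod (c n))\<^sup>2)" for c
  proof (rule LIMSEQ_le_const2)
    show "(\<lambda>N. (norm (\<Sum>n<N. c n *\<^sub>C f n))\<^sup>2) \<longlonglongrightarrow> (norm (\<Sum>n. c n *\<^sub>C f n))\<^sup>2"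
      by (intro tendsto_power tendsto_norm summable_LIMSEQ sm[OF c])
    have "(norm (\<Sum>n<N. c n *\<^sub>C f n))\<^sup>2 \<le> B * (\<Sum>n. (cmod (c n))\<^sup>2)" for N
    proof -
      have "(norm (\<Sum>n<N. c n *\<^sub>C f n))\<^sup>2 \<le> B * (\<Sum>n<N. (cmod (c n))\<^sup>2)" by (rule le) simp
      also have "\<dots> \<le> B * (\<Sum>n. (cmod (c n))\<^sup>2)"
        using B by (intro mult_left_mono sum_le_suminf c) auto
      finally show ?thesis .
    qed
    then show "\<exists>N0. \<forall>N\<ge>N0. (norm (\<Sum>n<N. c n *\<^sub>C f n))\<^sup>2 \<le> B * (\<Sum>n. (cmod (c n))\<^sup>2)"
      by blast
  qed
  with B show "\<exists>B>0. \<forall>c. summable (\<lambda>n. (cmod (c n))\<^sup>2) \<longrightarrow>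
      (norm (\<Sum>n. c n *\<^sub>C f n))\<^sup>2 \<le> B * (\<Sum>n. (cmod (c n))\<^sup>2)" by blast
qed

text \<open>Only a norm bound is asked of \<open>A\<close>, so that \<open>A\<close> may itself be
  an adjoint known through \<open>is_adjoint_bound\<close>. The constant
  \<open>K\<^sup>2 + 1\<close> in the proof keeps the new Bessel bound positive even if
  \<open>K\<close> is 0.\<close>

lemma bessel_seq_image:
  assumes f: "bessel_seq f" and adj: "is_adjoint A B" and A: "\<exists>K. \<forall>x. norm (A x) \<le> norm x * K"
  shows "bessel_seq (\<lambda>n. B (f n))"
proof -
  obtain C where C: "0 < C" "\<And>h. summable (\<lambda>n. (cmod (cinner h (f n)))\<^sup>2)"
    "\<And>h. (\<Sum>n. (cmod (cinner h (f n)))\<^sup>2) \<le> C * (norm h)\<^sup>2"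
    using bessel_seq_obtain[OF f] by metis
  obtain K where K: "\<And>x. norm (A x) \<le> norm x * K" using A by blast
  have eq: "cinner h (B (f n)) = cinner (A h) (f n)" for h n
    using adj by (simp add: is_adjoint_def)
  have "C * (norm (A h))\<^sup>2 \<le> (C * (K\<^sup>2 + 1)) * (norm h)\<^sup>2" for h
  proof -
    have "(norm (A h))\<^sup>2 \<le> (norm h * K)\<^sup>2" by (rule power_mono[OF K]) simp
    also have "\<dots> \<le> (K\<^sup>2 + 1) * (norm h)\<^sup>2" by (simp add: power_mult_distrib algebra_simps)
    finally show ?thesis using C(1) by (simp add: mult.assoc)
  qed
  then have "(\<Sum>n. (cmod (cinner h (B (f n))))\<^sup>2) \<le> (C * (K\<^sup>2 + 1)) * (norm h)\<^sup>2" for h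
    unfolding eq using C(3) order_trans by blast
  moreover have "0 < C * (K\<^sup>2 + 1)"
    using C(1) by (intro mult_pos_pos add_nonneg_pos) auto
  ultimately show ?thesis
    unfolding bessel_seq_def using C(2) by (auto simp: eq)
qed


section \<open>Multipliers and frame operators\<close>

lemma summable_weighted_analysis:
  assumes g: "bessel_seq g" and m: "\<And>n. cmod (m n) \<le> C"
  shows "summable (\<lambda>n. (cmod (m n * cinner h (g n)))\<^sup>2)"
    and "(\<Sum>n. (cmod (m n * cinner h (g n)))\<^sup>2) \<le> C\<^sup>2 * (\<Sum>n. (cmod (cinner h (g n)))\<^sup>2)"
proof -
  have s: "summable (\<lambda>n. (cmod (cinner h (g n)))\<^sup>2)"
    using bessel_seq_obtain[OF g] by metis
  then have sC: "summable (\<lambda>n. C\<^sup>2 * (cmod (cinner h (g n)))\<^sup>2)" by (rule summable_mult)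
  have le: "(cmod (m n * cinner h (g n)))\<^sup>2 \<le> C\<^sup>2 * (cmod (cinner h (g n)))\<^sup>2" for n
    using power_mono[OF m, of n 2] by (simp add: norm_mult power_mult_distrib mult_right_mono)
  show s': "summable (\<lambda>n. (cmod (m n * cinner h (g n)))\<^sup>2)"
    by (rule summable_comparison_test'[OF sC, of 0]) (simp add: le)
  show "(\<Sum>n. (cmod (m n * cinner h (g n)))\<^sup>2) \<le> C\<^sup>2 * (\<Sum>n. (cmod (cinner h (g n)))\<^sup>2)"
    using suminf_le[OF le s' sC] by (simp add: suminf_mult[OF s])
qed

lemma summable_multiplier:
  fixes f :: "nat \<Rightarrow> 'b::chilbert_space"
  assumes f: "bessel_seq f" and g: "bessel_seq g" and m: "\<And>n. cmod (m n) \<le> C"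
  shows "summable (\<lambda>n. (m n * cinner h (g n)) *\<^sub>C f n)"
  by (rule bessel_summable[OF f summable_weighted_analysis(1)[OF g m]])

text \<open>The bound is by the analysis coefficients rather than by the norm of \<open>h\<close>.
  Boundedness of multipliers follows from it, and so does the comparison of \<open>M\<close> with
  the frame operator of its analysis sequence.\<close>

lemma multiplier_bound:
  fixes f :: "nat \<Rightarrow> 'b::chilbert_space"
  assumes f: "bessel_seq f" and g: "bessel_seq g" and m: "\<And>n. cmod (m n) \<le> C"
  shows "\<exists>K\<ge>0. \<forall>h. (norm (multiplier m f g h))\<^sup>2 \<le> K * (\<Sum>n. (cmod (cinner h (g n)))\<^sup>2)"
proof -
  obtain B where B: "0 < B" and le: "\<And>c. summable (\<lambda>n. (cmod (c n))\<^sup>2) \<Longrightarrow>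
      (norm (\<Sum>n. c n *\<^sub>C f n))\<^sup>2 \<le> B * (\<Sum>n. (cmod (c n))\<^sup>2)"
    using bessel_norm_suminf_le[OF f] by blast
  have "(norm (multiplier m f g h))\<^sup>2 \<le> (B * C\<^sup>2) * (\<Sum>n. (cmod (cinner h (g n)))\<^sup>2)" for h
  proof -
    have "(norm (multiplier m f g h))\<^sup>2 \<le> B * (\<Sum>n. (cmod (m n * cinner h (g n)))\<^sup>2)"
      unfolding multiplier_def by (rule le[OF summable_weighted_analysis(1)[OF g m]])
    also have "\<dots> \<le> B * (C\<^sup>2 * (\<Sum>n. (cmod (cinner h (g n)))\<^sup>2))"
      using B by (intro mult_left_mono summable_weighted_analysis(2)[OF g m]) simp
    finally show ?thesis by (simp add: mult.assoc)
  qed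
  moreover have "0 \<le> B * C\<^sup>2" using B by simp
  ultimately show ?thesis by blast
qed

lemma bounded_clinear_suminf:
  fixes A :: "'a::complex_inner \<Rightarrow> 'b::complex_inner"
  assumes A: "bounded_clinear A" and s: "summable (\<lambda>n. c n *\<^sub>C f n)"
  shows "A (\<Sum>n. c n *\<^sub>C f n) = (\<Sum>n. c n *\<^sub>C A (f n))"
  using bounded_linear.suminf[OF bounded_clinear_imp_bounded_linear[OF A] s]
  by (simp add: bounded_clinear_scaleC[OF A])

lemma bounded_clinear_scaleC_right: "bounded_clinear (\<lambda>x::'a::complex_inner. c *\<^sub>C x)"
  unfolding bounded_clinear_iff
proof
  show "bounded_linear (\<lambda>x::'a. c *\<^sub>C x)"
    by (rule bounded_linear_intro[of _ "cmod c"])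
      (simp_all add: scaleC_add_right norm_scaleC scaleC_scaleR_commute mult.commute)
qed (simp add: scaleC_scaleC mult.commute)

lemma bounded_clinear_multiplier:
  fixes f :: "nat \<Rightarrow> 'b::chilbert_space" and g :: "nat \<Rightarrow> 'a::chilbert_space"
  assumes f: "bessel_seq f" and g: "bessel_seq g" and m: "\<And>n. cmod (m n) \<le> C"
  shows "bounded_clinear (multiplier m f g)"
proof -
  note sm = summable_multiplier[where m = m, OF f g m]
  have add: "multiplier m f g (x + y) = multiplier m f g x + multiplier m f g y" for x y
    unfolding multiplier_def suminf_add[OF sm sm]
    by (simp add: cinner_add_left distrib_left scaleC_add_left)
  have scale: "multiplier m f g (c *\<^sub>C x) = c *\<^sub>C multiplier m f g x" for c x
    unfolding multiplier_def
    using bounded_clinear_suminf[OF bounded_clinear_scaleC_right[of c] sm[of x]]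
    by (simp add: cinner_scaleC_left scaleC_scaleC mult_ac)
  obtain K where K: "0 \<le> K"
    "\<And>h. (norm (multiplier m f g h))\<^sup>2 \<le> K * (\<Sum>n. (cmod (cinner h (g n)))\<^sup>2)"
    using multiplier_bound[where m = m, OF f g m] by blast
  obtain B where B: "0 < B" "\<And>h. (\<Sum>n. (cmod (cinner h (g n)))\<^sup>2) \<le> B * (norm h)\<^sup>2"
    using bessel_seq_obtain[OF g] by metis
  have "norm (multiplier m f g h) \<le> norm h * sqrt (K * B)" for h
  proof (rule power2_le_imp_le)
    have "(norm (multiplier m f g h))\<^sup>2 \<le> K * (B * (norm h)\<^sup>2)"
      using K B(2) by (meson mult_left_mono order_trans)
    then show "(norm (multiplier m f g h))\<^sup>2 \<le> (norm h * sqrt (K * B))\<^sup>2"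
      using K B(1) by (simp add: power_mult_distrib mult_ac)
  qed (use K B in simp)
  with add scale show ?thesis
    by (auto simp: bounded_clinear_def Vector_Spaces.linear_iff complex_vector.vector_space_axioms)
qed

lemma bounded_clinear_multiplier_image:
  fixes f :: "nat \<Rightarrow> 'b::chilbert_space" and A :: "'b \<Rightarrow> 'c::complex_inner"
  assumes A: "bounded_clinear A"
    and f: "bessel_seq f" and g: "bessel_seq g" and m: "\<And>n. cmod (m n) \<le> C"
  shows "A (multiplier m f g h) = multiplier m (\<lambda>n. A (f n)) g h"
  unfolding multiplier_def by (rule bounded_clinear_suminf[OF A summable_multiplier[OF f g m]])

lemma frame_op_eq_multiplier: "frame_op f = multiplier (\<lambda>_. 1) f f"
  by (simp add: fun_eq_iff frame_op_def multiplier_def)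

lemma bounded_clinear_frame_op:
  fixes f :: "nat \<Rightarrow> 'a::chilbert_space"
  assumes "bessel_seq f"
  shows "bounded_clinear (frame_op f)"
  unfolding frame_op_eq_multiplier by (rule bounded_clinear_multiplier[OF assms assms, of _ 1]) simp

lemma cinner_frame_op:
  fixes f :: "nat \<Rightarrow> 'a::chilbert_space"
  assumes f: "bessel_seq f"
  shows "(\<lambda>n. cinner x (f n) * cinner (f n) y) sums cinner (frame_op f x) y"
proof -
  have s: "summable (\<lambda>n. cinner x (f n) *\<^sub>C f n)"
    using summable_multiplier[OF f f, of "\<lambda>_. 1" 1] by simp
  from bounded_linear.sums[OF bounded_linear_cinner_left summable_sums[OF s]]
  show ?thesis by (simp add: frame_op_def cinner_scaleC_left)
qed

lemma is_adjoint_frame_op: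
  fixes f :: "nat \<Rightarrow> 'a::chilbert_space"
  assumes f: "bessel_seq f"
  shows "is_adjoint (frame_op f) (frame_op f)"
  unfolding is_adjoint_def
proof (intro allI)
  fix x y
  have "(\<lambda>n. cnj (cinner y (f n) * cinner (f n) x)) sums cnj (cinner (frame_op f y) x)"
    unfolding sums_cnj by (rule cinner_frame_op[OF f])
  then have "(\<lambda>n. cinner x (f n) * cinner (f n) y) sums cinner x (frame_op f y)"
    by (simp add: mult.commute flip: cinner_commute)
  with cinner_frame_op[OF f] show "cinner (frame_op f x) y = cinner x (frame_op f y)"
    by (rule sums_unique2)
qed

text \<open>The sum equals <S h, h>, so Cauchy-Schwarz applies; this converts control of the
  coefficients into control by the frame operator.\<close>

lemma analysis_square_sum_le:
  fixes f :: "nat \<Rightarrow> 'a::chilbert_space"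
  assumes f: "bessel_seq f"
  shows "(\<Sum>n. (cmod (cinner h (f n)))\<^sup>2) \<le> norm (frame_op f h) * norm h"
proof -
  have s: "summable (\<lambda>n. (cmod (cinner h (f n)))\<^sup>2)"
    using bessel_seq_obtain[OF f] by metis
  have "cinner h (f n) * cinner (f n) h = of_real ((cmod (cinner h (f n)))\<^sup>2)" for n
    by (subst cinner_commute[of "f n" h]) (simp only: complex_norm_square)
  then have "(\<lambda>n. complex_of_real ((cmod (cinner h (f n)))\<^sup>2)) sums cinner (frame_op f h) h"
    using cinner_frame_op[OF f, of h h] by simp
  moreover have "(\<lambda>n. complex_of_real ((cmod (cinner h (f n)))\<^sup>2)) sums
      of_real (\<Sum>n. (cmod (cinner h (f n)))\<^sup>2)"
    by (rule sums_of_real[OF summable_sums[OF s]])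
  ultimately have "cinner (frame_op f h) h = of_real (\<Sum>n. (cmod (cinner h (f n)))\<^sup>2)"
    by (rule sums_unique2)
  then have "cmod (cinner (frame_op f h) h) = (\<Sum>n. (cmod (cinner h (f n)))\<^sup>2)"
    by (simp add: suminf_nonneg[OF s])
  with norm_cinner_le[of "frame_op f h" h] show ?thesis by simp
qed


section \<open>The oblique pseudoinverse as a multiplier\<close>

lemma oblique_pinv_eqI:
  assumes M: "bounded_clinear M" and W: "oblique_decomp W (ker M)"
    and V: "oblique_decomp (range M) V"
    and x: "x \<in> W" and y: "y - M x \<in> V"
  shows "oblique_pinv W V M y = x"
  unfolding oblique_pinv_def
proof (rule the_equality)
  show "x \<in> W \<and> (\<exists>z\<in>V. y = M x + z)" using x y by (metis add.commute diff_add_cancel)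
next
  fix x' assume x': "x' \<in> W \<and> (\<exists>z\<in>V. y = M x' + z)"
  then have "y - M x' \<in> V" by auto
  \<comment> \<open>Both are the projection of \<open>y\<close> onto the range along
    \<open>V\<close>.\<close>
  then have "M x' = M x"
    using oblique_decomp.proj_eqI[OF V] y by (metis rangeI)
  then have "x' - x \<in> ker M"
    using linear_diff[OF bounded_linear.linear[OF bounded_clinear_imp_bounded_linear[OF M]]]
    by (simp add: ker_def)
  then show "x' = x" using oblique_decomp.unique[OF W] x x' by blast
qed

theorem proposition7p1:
  fixes \<psi> :: "nat \<Rightarrow> 'a::chilbert_space"
    and \<phi> :: "nat \<Rightarrow> 'b::chilbert_space"
    and m :: "nat \<Rightarrow> complex"
    and W :: "'a set" and V :: "'b set"
    and M :: "'a \<Rightarrow> 'b"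
    and \<psi>K \<psi>K_dual :: "nat \<Rightarrow> 'a"
    and \<phi>R \<phi>R_dual :: "nat \<Rightarrow> 'b"
  assumes "separable_space (euclidean :: 'a topology)"
    and "separable_space (euclidean :: 'b topology)"
    and "bessel_seq \<psi>" and "bessel_seq \<phi>"
    and "semi_normalized m"
    and M: "M = multiplier m \<phi> \<psi>"
    and "closed (range M)"
    and "closed_csubspace W" and "closed_csubspace V"
    and "direct_sum_decomp W (ker M)"
    and "direct_sum_decomp (range M) V"
    and \<psi>K: "\<psi>K = (\<lambda>n. cadjoint (oblique_proj W (ker M)) (\<psi> n))"
    and \<phi>R: "\<phi>R = (\<lambda>n. oblique_proj (range M) V (\<phi> n))"
    and \<psi>K_dual: "\<psi>K_dual =
      (\<lambda>n. oblique_proj W (ker M) (moore_penrose (frame_op \<psi>K) (\<psi>K n)))"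
    and \<phi>R_dual: "\<phi>R_dual =
      (\<lambda>n. cadjoint (oblique_proj (range M) V) (moore_penrose (frame_op \<phi>R) (\<phi>R n)))"
    and "\<exists>U. bounded_clinear U \<and> (\<forall>n. U (\<phi>R n) = cnj (m n) *\<^sub>C \<psi>K n)"
  shows "oblique_pinv W V M = multiplier (\<lambda>n. 1 / m n) \<psi>K_dual \<phi>R_dual"
proof -
  note \<psi> = assms(3) and \<phi> = assms(4)
  obtain C where C: "\<And>n. cmod (m n) \<le> C"
    using assms(5) by (auto simp: semi_normalized_def bdd_above_def)
  have m0: "m n \<noteq> 0" for n
  proof
    assume "m n = 0"
    have "(INF n. cmod (m n)) \<le> cmod (m n)"
      by (rule cINF_lower) (auto intro: bdd_belowI2[of _ 0])
    with \<open>m n = 0\<close> assms(5) show False by (simp add: semi_normalized_def)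
  qed
  have M_lin: "bounded_clinear M" unfolding M by (rule bounded_clinear_multiplier[OF \<phi> \<psi> C])
  interpret M: bounded_linear M using M_lin by (rule bounded_clinear_imp_bounded_linear)
  have K: "closed_csubspace (ker M)" by (rule closed_csubspace_ker[OF M_lin])
  have R: "closed_csubspace (range M)" using csubspace_range[OF M_lin] assms(7) by blast
  interpret K: oblique_decomp W "ker M" using assms(8,10) K by unfold_locales auto
  interpret R: oblique_decomp "range M" V using assms(9,11) R by unfold_locales auto
  define P where "P = oblique_proj W (ker M)"
  define Q where "Q = oblique_proj (range M) V"
  have P: "bounded_clinear P"
    unfolding P_def by (rule bounded_clinear_oblique_proj[OF assms(8) K assms(10)])
  have Q: "bounded_clinear Q"
    unfolding Q_def by (rule bounded_clinear_oblique_proj[OF R assms(9) assms(11)])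
  have MP: "M (P h) = M h" for h
    using K.proj_residual[of h] by (simp add: ker_def M.diff P_def)
  have QM: "Q (M h) = M h" for h unfolding Q_def by (rule R.proj_fix) simp
  have P_adj: "is_adjoint P (cadjoint P)" and Q_adj: "is_adjoint Q (cadjoint Q)"
    using P Q by (simp_all add: is_adjoint_cadjoint)
  have \<psi>K_cinner: "cinner h (\<psi>K n) = cinner (P h) (\<psi> n)" for h n
    using P_adj by (simp add: \<psi>K is_adjoint_def P_def)
  have \<psi>K_bessel: "bessel_seq \<psi>K"
    unfolding \<psi>K P_def[symmetric]
    by (rule bessel_seq_image[OF \<psi> P_adj]) (use P in \<open>simp add: bounded_clinear_def\<close>)
  \<comment> \<open>The projection here acts on the sequence itself, not through its adjoint, so the
    roles swap and the bound is needed for \<open>cadjoint Q\<close>.\<close>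
  have \<phi>R_bessel: "bessel_seq \<phi>R"
    unfolding \<phi>R Q_def[symmetric]
    by (rule bessel_seq_image[OF \<phi> is_adjoint_sym[OF Q_adj] is_adjoint_bound[OF Q_adj Q]])
  have M_eq: "M h = multiplier m \<phi>R \<psi>K h" for h
  proof -
    have "M h = Q (multiplier m \<phi> \<psi> (P h))" by (simp add: MP QM flip: M)
    also have "\<dots> = multiplier m \<phi>R \<psi> (P h)"
      unfolding \<phi>R Q_def[symmetric] by (rule bounded_clinear_multiplier_image[OF Q \<phi> \<psi> C])
    finally show ?thesis by (simp add: multiplier_def \<psi>K_cinner)
  qed

  let ?S = "frame_op \<phi>R" and ?T = "frame_op \<psi>K"
  have S: "bounded_clinear ?S" by (rule bounded_clinear_frame_op[OF \<phi>R_bessel])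
  have T: "bounded_clinear ?T" by (rule bounded_clinear_frame_op[OF \<psi>K_bessel])
  interpret T: bounded_linear ?T using T by (rule bounded_clinear_imp_bounded_linear)
  obtain U where U: "bounded_clinear U" "\<And>n. U (\<phi>R n) = cnj (m n) *\<^sub>C \<psi>K n"
    using assms(16) by blast
  define U' where "U' = cadjoint U"
  have U': "cinner (U' x) (\<phi>R n) = m n * cinner x (\<psi>K n)" for x n
  proof -
    have "cinner (U' x) (\<phi>R n) = cinner x (U (\<phi>R n))"
      using is_adjoint_sym[OF is_adjoint_cadjoint[OF U(1)]] by (simp add: is_adjoint_def U'_def)
    then show ?thesis by (simp add: U(2) cinner_scaleC_right)
  qed
  then have M_factor: "M x = ?S (U' x)" for x
    by (simp add: M_eq multiplier_def frame_op_def)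
  have S_in: "?S h \<in> range M" for h
  proof -
    \<comment> \<open>\<open>Q\<close> is pulled out of the synthesis side only, so every value of
      the frame operator is visibly a value of \<open>Q\<close>.\<close>
    have "Q (multiplier (\<lambda>_. 1) \<phi> \<phi>R h) = multiplier (\<lambda>_. 1) \<phi>R \<phi>R h"
      unfolding \<phi>R Q_def[symmetric]
      by (rule bounded_clinear_multiplier_image[OF Q \<phi> \<phi>R_bessel[unfolded \<phi>R, folded Q_def], of _ 1]) simp
    then show ?thesis unfolding frame_op_eq_multiplier Q_def by (metis R.proj_in)
  qed
  have range_S: "range ?S = range M"
    using S_in M_factor by auto
  define S' where "S' = moore_penrose ?S"
  have S_adj: "is_adjoint ?S ?S" by (rule is_adjoint_frame_op[OF \<phi>R_bessel])
  have S': "is_moore_penrose ?S S'"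
    unfolding S'_def by (rule is_moore_penrose_moore_penrose[OF S]) (simp add: range_S assms(7))
  have S'_adj: "is_adjoint S' S'" by (rule is_adjoint_moore_penrose[OF S_adj S'])
  \<comment> \<open>\<open>\<phi>R n\<close> lies in the range of \<open>?S\<close>, which
    \<open>?S \<circ> S'\<close> fixes; the two factors commute since \<open>?S\<close> is
    self-adjoint.\<close>
  have S'_fix: "S' (?S (\<phi>R n)) = \<phi>R n" for n
  proof -
    have "\<phi>R n \<in> range ?S"
      unfolding range_S by (simp add: \<phi>R R.proj_in)
    then obtain g where g: "\<phi>R n = ?S g" by (rule imageE)
    have "?S (S' (?S g)) = ?S g" using S' by (simp add: is_moore_penrose_def fun_eq_iff)
    with moore_penrose_commute[OF S_adj S', of "?S g"] show ?thesis unfolding g by simp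
  qed
  have dual_coeff: "cinner y (\<phi>R_dual n) = m n * cinner x (\<psi>K n)" if "Q y = M x" for x y n
  proof -
    have "cinner y (\<phi>R_dual n) = cinner (Q y) (S' (\<phi>R n))"
      using Q_adj by (simp add: \<phi>R_dual is_adjoint_def Q_def S'_def)
    also have "\<dots> = cinner (S' (?S (U' x))) (\<phi>R n)"
      using S'_adj by (simp add: that M_factor is_adjoint_def)
    also have "\<dots> = cinner (U' x) (S' (?S (\<phi>R n)))"
      using S' by (simp add: is_moore_penrose_def is_adjoint_def)
    finally show ?thesis by (simp add: S'_fix U')
  qed

  obtain B where B: "0 \<le> B" "\<And>h. (norm (M h))\<^sup>2 \<le> B * (\<Sum>n. (cmod (cinner h (\<psi>K n)))\<^sup>2)"
    using multiplier_bound[where m = m, OF \<phi>R_bessel \<psi>K_bessel C] unfolding M_eq by blast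
  have M_le_T: "(norm (M h))\<^sup>2 \<le> B * (norm (?T h) * norm h)" for h
    by (rule order_trans[OF B(2)]) (intro mult_left_mono analysis_square_sum_le \<psi>K_bessel B(1))
  have "?T h = 0 \<longleftrightarrow> M h = 0" for h
  proof
    assume "?T h = 0"
    with M_le_T[of h] show "M h = 0" by simp
  next
    assume "M h = 0"
    then have "h \<in> ker M" by (simp add: ker_def)
    then have "P h = 0" by (simp add: P_def K.proj_0_iff)
    then show "?T h = 0" by (simp add: frame_op_def \<psi>K_cinner)
  qed
  then have ker_T: "ker ?T = ker M" by (simp add: ker_def)
  obtain c where c: "\<And>h. h \<in> orthogonal_complement (ker M) \<Longrightarrow> norm h \<le> norm (M h) * c"
    using bounded_below_if_closed_range[OF M_lin assms(7)] by blast
  \<comment> \<open>For h orthogonal to the kernel, norm h^2 \<le> c^2 * norm (M h)^2 \<le> B * c^2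
    * norm (T h) * norm h; cancelling norm h gives the constant
    \<open>B * c\<^sup>2\<close>.\<close>
  have "closed (range ?T)"
  proof (rule closed_range_if_bounded_below[OF T])
    fix h assume "h \<in> orthogonal_complement (ker ?T)"
    then have "norm h \<le> norm (M h) * c" unfolding ker_T by (rule c)
    then have "(norm h)\<^sup>2 \<le> (norm (M h) * c)\<^sup>2" by (rule power_mono) simp
    also have "\<dots> = (norm (M h))\<^sup>2 * c\<^sup>2" by (rule power_mult_distrib)
    also have "\<dots> \<le> B * (norm (?T h) * norm h) * c\<^sup>2"
      by (intro mult_right_mono M_le_T) simp
    finally have "norm h * norm h \<le> (norm (?T h) * (B * c\<^sup>2)) * norm h"
      by (simp add: power2_eq_square mult_ac)
    then show "norm h \<le> norm (?T h) * (B * c\<^sup>2)"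
      using B(1) by (cases "h = 0") auto
  qed
  then have T': "is_moore_penrose ?T (moore_penrose ?T)"
    by (rule is_moore_penrose_moore_penrose[OF T])
  have PT'T: "P (moore_penrose ?T (?T x)) = x" if "x \<in> W" for x
  proof -
    \<comment> \<open>\<open>x\<close> and its image under T^+ T differ by an element of the common
      kernel, along which \<open>P\<close> projects.\<close>
    have "?T (x - moore_penrose ?T (?T x)) = 0"
      using T' by (simp add: is_moore_penrose_def fun_eq_iff T.diff)
    then have "x - moore_penrose ?T (?T x) \<in> ker M" unfolding ker_T[symmetric] by (simp add: ker_def)
    from complex_vector.subspace_neg[OF K.Z this]
    show ?thesis using that unfolding P_def by (intro K.proj_eqI) auto
  qed

  show ?thesis
  proof
    fix y
    obtain h where h: "Q y = M h" using R.proj_in[of y] by (auto simp: Q_def)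
    define x where "x = P h"
    have xW: "x \<in> W" by (simp add: x_def P_def K.proj_in)
    have Qy: "Q y = M x" by (simp add: h x_def MP)
    have "oblique_pinv W V M y = x"
    proof (rule oblique_pinv_eqI[OF M_lin K.oblique_decomp_axioms R.oblique_decomp_axioms xW])
      show "y - M x \<in> V" unfolding Qy[symmetric] Q_def by (rule R.proj_residual)
    qed
    also have "x = P (moore_penrose ?T (?T x))" by (rule PT'T[OF xW, symmetric])
    also have "\<dots> = (\<Sum>n. cinner x (\<psi>K n) *\<^sub>C \<psi>K_dual n)"
    proof -
      have "bounded_clinear (P \<circ> moore_penrose ?T)"
        using P T' by (auto simp: bounded_clinear_iff is_moore_penrose_def o_def
            intro: bounded_linear_compose)
      from bounded_clinear_suminf[OF this, of "\<lambda>n. cinner x (\<psi>K n)" \<psi>K]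
        summable_multiplier[OF \<psi>K_bessel \<psi>K_bessel, of "\<lambda>_. 1" 1 x]
      show ?thesis by (simp add: frame_op_def \<psi>K_dual P_def)
    qed
    \<comment> \<open>The two series agree term by term, since 1 / m_n times the coefficient m_n *
      <x, \<psi>^K_n> leaves the frame coefficient of \<open>x\<close>.\<close>
    also have "\<dots> = multiplier (\<lambda>n. 1 / m n) \<psi>K_dual \<phi>R_dual y"
      by (simp add: multiplier_def dual_coeff[OF Qy] m0)
    finally show "oblique_pinv W V M y = multiplier (\<lambda>n. 1 / m n) \<psi>K_dual \<phi>R_dual y" .
  qed
qed

end
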